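(* Let $(E,w,d)$ be a $\mathbb{V}$-ultra triple such that $E$ is finite, and let $\mathcal{F}$ be the Bhargava greedoid of $(E,w,d)$. Let $\mathbb{K}$ be a field with $|\mathbb{K}|\geq |E|$. Then $\mathcal{F}$ is the Gaussian elimination greedoid of a vector family over $\mathbb{K}$.
   Context: $\mathbb{V}$ is a totally ordered abelian group (the total order is translation-invariant: $a\le b$ implies $a+c\le b+c$). For a set $E$, let $E\times_{\neq}E=\{(e,f)\in E\times E: e\neq f\}$. A $\mathbb{V}$-ultra triple is a triple $(E,w,d)$ where $E$ is a set, $w:E\to\mathbb{V}$ is a map, and $d:E\times_{\neq}E\to\mathbb{V}$ is a map satisfying $d(a,b)=d(b,a)$ for distinct $a,b\in E$ and $d(a,b)\le\max\{d(a,c),d(b,c)\}$ for any three distinct $a,b,c\in E$. The perimeter of a finite $A\subseteq E$ is $\mathrm{PER}(A)=\sum_{a\in A}w(a)+\sum_{\{a,b\}\subseteq A,\ a\neq b}d(a,b)$ (second sum over unordered pairs of distinct elements). For finite $E$, the Bhargava greedoid of $(E,w,d)$ is $\{A\subseteq E:\ \mathrm{PER}(A)\ge\mathrm{PER}(B)\text{ for all }B\subseteq E\text{ with }|B|=|A|\}$. Gaussian elimination greedoid: let $E$ be a finite set, $\mathbb{K}$ a field, $m\in\mathbb{N}$ with $m\ge|E|$, and $v_e\in\mathbb{K}^m$ (column vectors) for each $e\in E$ (a vector family over $\mathbb{K}$). For $k\in\{0,\dots,m\}$ let $\pi_k:\mathbb{K}^m\to\mathbb{K}^k$ keep the first $k$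 coordinates. The Gaussian elimination greedoid of $(v_e)_{e\in E}$ is $\{F\subseteq E:\ (\pi_{|F|}(v_e))_{e\in F}\text{ is linearly independent in }\mathbb{K}^{|F|}\}$. *)

theory Defs
  imports
    "Jordan_Normal_Form.VS_Connect"
    "HOL-Library.Equipollence"
begin

section \<open>Ultra triples, perimeter, Bhargava greedoid\<close>

text \<open>
  The distance is a total binary function; its values on the diagonal and outside \<open>E\<close>
  are unconstrained and are never used.
\<close>

definition ultra_triple ::
  "'e set \<Rightarrow> ('e \<Rightarrow> 'v::linordered_ab_group_add) \<Rightarrow> ('e \<Rightarrow> 'e \<Rightarrow> 'v) \<Rightarrow> bool" where
  "ultra_triple E w d \<longleftrightarrow>
     (\<forall>a\<in>E. \<forall>b\<in>E. a \<noteq> b \<longrightarrow> d a b = d b a) \<and>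
     (\<forall>a\<in>E. \<forall>b\<in>E. \<forall>c\<in>E. a \<noteq> b \<and> a \<noteq> c \<and> b \<noteq> c \<longrightarrow> d a b \<le> max (d a c) (d b c))"

text \<open>
  The value of \<open>d\<close> on an unordered pair \<open>P = {a, b}\<close> with \<open>a \<noteq> b\<close>.  It is well defined
  when \<open>d a b = d b a\<close>, see \<open>pair_dist_doubleton\<close>.
\<close>

definition pair_dist :: "('e \<Rightarrow> 'e \<Rightarrow> 'v) \<Rightarrow> 'e set \<Rightarrow> 'v" where
  "pair_dist d P = (THE x. \<exists>a b. a \<noteq> b \<and> P = {a, b} \<and> x = d a b)"

definition PER ::
  "('e \<Rightarrow> 'v::linordered_ab_group_add) \<Rightarrow> ('e \<Rightarrow> 'e \<Rightarrow> 'v) \<Rightarrow> 'e set \<Rightarrow> 'v" where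
  "PER w d A = (\<Sum>a\<in>A. w a) + (\<Sum>P | P \<subseteq> A \<and> card P = 2. pair_dist d P)"

definition bhargava_greedoid ::
  "'e set \<Rightarrow> ('e \<Rightarrow> 'v::linordered_ab_group_add) \<Rightarrow> ('e \<Rightarrow> 'e \<Rightarrow> 'v) \<Rightarrow> 'e set set" where
  "bhargava_greedoid E w d =
     {A. A \<subseteq> E \<and> (\<forall>B. B \<subseteq> E \<and> card B = card A \<longrightarrow> PER w d A \<ge> PER w d B)}"

lemma pair_dist_doubleton:
  assumes "a \<noteq> b" "d a b = d b a"
  shows "pair_dist d {a, b} = d a b"
  unfolding pair_dist_def
proof (rule the_equality)
  show "\<exists>x y. x \<noteq> y \<and> {a, b} = {x, y} \<and> d a b = d x y"
    using assms(1) by blast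
qed (use assms in \<open>auto simp: doubleton_eq_iff\<close>)

lemma PER_empty [simp]: "PER w d {} = 0"
proof -
  have none: "{P. P \<subseteq> {} \<and> card P = 2} = {}"
    by auto
  show ?thesis unfolding PER_def none by simp
qed

lemma PER_insert:
  assumes fin: "finite A" and x: "x \<notin> A" and sym: "\<And>a. a \<in> A \<Longrightarrow> d x a = d a x"
  shows "PER w d (insert x A) = PER w d A + w x + (\<Sum>a\<in>A. d x a)"
proof -
  let ?S = "{P. P \<subseteq> A \<and> card P = 2}" and ?T = "(\<lambda>a. {x, a}) ` A"
  have eq: "{P. P \<subseteq> insert x A \<and> card P = 2} = ?S \<union> ?T" (is "?L = _")
  proof (intro equalityI subsetI)
    fix P assume "P \<in> ?L"
    then have P: "P \<subseteq> insert x A" "card P = 2" by auto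
    then obtain a b where ab: "P = {a, b}" "a \<noteq> b" by (auto simp: card_2_iff)
    show "P \<in> ?S \<union> ?T"
    proof (cases "x \<in> P")
      case True
      then show ?thesis using P ab by (auto simp: insert_commute)
    next
      case False
      then show ?thesis using P by auto
    qed
  next
    fix P assume "P \<in> ?S \<union> ?T"
    moreover have "card {x, a} = 2" if "a \<in> A" for a
      using that x by (auto simp: card_insert_if)
    ultimately show "P \<in> ?L" by auto
  qed
  have inj: "inj_on (\<lambda>a. {x, a}) A"
    by (auto simp: inj_on_def doubleton_eq_iff)
  have finS: "finite ?S" using fin by simp
  have "?S \<inter> ?T = {}" using x by auto
  then have "(\<Sum>P\<in>?S \<union> ?T. pair_dist d P) = (\<Sum>P\<in>?S. pair_dist d P) + (\<Sum>P\<in>?T. pair_dist d P)"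
    using fin finS by (intro sum.union_disjoint) auto
  also have "(\<Sum>P\<in>?T. pair_dist d P) = (\<Sum>a\<in>A. pair_dist d {x, a})"
    using inj by (simp add: sum.reindex)
  also have "\<dots> = (\<Sum>a\<in>A. d x a)"
  proof (rule sum.cong)
    fix a assume "a \<in> A"
    then show "pair_dist d {x, a} = d x a"
      using x sym by (intro pair_dist_doubleton) auto
  qed simp
  finally show ?thesis
    unfolding PER_def eq using fin x by (simp add: algebra_simps)
qed


section \<open>Gaussian elimination greedoid\<close>

text \<open>
  Linear independence of a \<^emph>\<open>family\<close> (a repeated vector makes the family dependent), in
  contrast to the library's \<open>lin_indpt\<close>, which is a property of a set of vectors;
  see \<open>lin_indpt_family_iff\<close>.
\<close>

definition lin_indpt_family :: "nat \<Rightarrow> ('e \<Rightarrow> 'k::field vec) \<Rightarrow> 'e set \<Rightarrow> bool" where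
  "lin_indpt_family k u F \<longleftrightarrow>
     (\<forall>c :: 'e \<Rightarrow> 'k. finsum_vec TYPE('k) k (\<lambda>e. c e \<cdot>\<^sub>v u e) F = 0\<^sub>v k \<longrightarrow> (\<forall>e\<in>F. c e = 0))"

definition vector_family :: "nat \<Rightarrow> 'e set \<Rightarrow> ('e \<Rightarrow> 'k::field vec) \<Rightarrow> bool" where
  "vector_family m E v \<longleftrightarrow> card E \<le> m \<and> (\<forall>e\<in>E. v e \<in> carrier_vec m)"

text \<open>\<open>vec_first x k\<close> consists of the first \<open>k\<close> coordinates of \<open>x\<close>.\<close>

definition gaussian_elimination_greedoid :: "'e set \<Rightarrow> ('e \<Rightarrow> 'k::field vec) \<Rightarrow> 'e set set" where
  "gaussian_elimination_greedoid E v =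
     {F. F \<subseteq> E \<and> lin_indpt_family (card F) (\<lambda>e. vec_first (v e) (card F)) F}"

lemma (in vec_space) lin_indpt_family_iff:
  assumes fin: "finite F" and u: "\<And>e. e \<in> F \<Longrightarrow> u e \<in> carrier_vec n"
  shows "lin_indpt_family n u F \<longleftrightarrow> inj_on u F \<and> lin_indpt (u ` F)"
proof -
  have zero_iff: "finsum_vec TYPE('a) n (\<lambda>e. c e \<cdot>\<^sub>v u e) F = 0\<^sub>v n \<longleftrightarrow>
      (\<forall>i<n. (\<Sum>e\<in>F. c e * u e $ i) = 0)" for c
  proof -
    have cl: "finsum_vec TYPE('a) n (\<lambda>e. c e \<cdot>\<^sub>v u e) F \<in> carrier_vec n"
      using u by (intro finsum_vec_closed) auto
    have ix: "finsum_vec TYPE('a) n (\<lambda>e. c e \<cdot>\<^sub>v u e) F $ i = (\<Sum>e\<in>F. c e * u e $ i)"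
      if "i < n" for i
    proof -
      have "finsum_vec TYPE('a) n (\<lambda>e. c e \<cdot>\<^sub>v u e) F $ i = (\<Sum>e\<in>F. (c e \<cdot>\<^sub>v u e) $ i)"
        using u by (intro index_finsum_vec[OF fin that]) auto
      also have "\<dots> = (\<Sum>e\<in>F. c e * u e $ i)"
      proof (rule sum.cong)
        fix e assume "e \<in> F"
        then have "dim_vec (u e) = n" using u by auto
        then show "(c e \<cdot>\<^sub>v u e) $ i = c e * u e $ i" using that by simp
      qed simp
      finally show ?thesis .
    qed
    show ?thesis
    proof
      assume "finsum_vec TYPE('a) n (\<lambda>e. c e \<cdot>\<^sub>v u e) F = 0\<^sub>v n"
      then show "\<forall>i<n. (\<Sum>e\<in>F. c e * u e $ i) = 0" using ix by (metis index_zero_vec(1))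
    next
      assume "\<forall>i<n. (\<Sum>e\<in>F. c e * u e $ i) = 0"
      then show "finsum_vec TYPE('a) n (\<lambda>e. c e \<cdot>\<^sub>v u e) F = 0\<^sub>v n"
        using cl ix by (intro eq_vecI) (simp_all add: carrier_vecD[OF cl] del: finsum_vec)
    qed
  qed
  have uF: "u ` F \<subseteq> carrier_vec n" using u by auto
  show ?thesis
  proof
    assume L: "lin_indpt_family n u F"
    have coeffs: "\<forall>e\<in>F. c e = 0" if "\<And>i. i < n \<Longrightarrow> (\<Sum>e\<in>F. c e * u e $ i) = 0" for c
      using L that zero_iff[of c] unfolding lin_indpt_family_def by blast
    have inj: "inj_on u F"
    proof (rule inj_onI, rule ccontr)
      fix x y assume xy: "x \<in> F" "y \<in> F" "u x = u y" "x \<noteq> y"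
      let ?c = "\<lambda>e. if e = x then 1 else if e = y then -1 else (0::'a)"
      have "(\<Sum>e\<in>F. ?c e * u e $ i) = 0" for i
      proof -
        have "?c e * u e $ i = (if e = x then u x $ i else 0) - (if e = y then u x $ i else 0)" for e
          using xy(3,4) by (cases "e = x"; cases "e = y") simp_all
        then have "(\<Sum>e\<in>F. ?c e * u e $ i)
            = (\<Sum>e\<in>F. if e = x then u x $ i else 0) - (\<Sum>e\<in>F. if e = y then u x $ i else 0)"
          by (simp only: sum_subtractf)
        then show ?thesis
          using xy(1,2) by (simp only: sum.delta[OF fin] if_True diff_self)
      qed
      then have "\<forall>e\<in>F. ?c e = 0" by (intro coeffs)
      with xy(1) show False by auto
    qed
    have "lin_indpt (u ` F)"
    proof
      assume "lin_dep (u ` F)"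
      then obtain A a v where A: "finite A" "A \<subseteq> u ` F" "lincomb a A = 0\<^sub>v n" "v \<in> A" "a v \<noteq> 0"
        unfolding lin_dep_def by auto
      let ?c = "\<lambda>e. if u e \<in> A then a (u e) else 0"
      have "(\<Sum>e\<in>F. ?c e * u e $ i) = 0" if i: "i < n" for i
      proof -
        have "(\<Sum>e\<in>F. ?c e * u e $ i) = (\<Sum>x\<in>u ` F. (if x \<in> A then a x else 0) * x $ i)"
          by (simp add: sum.reindex[OF inj])
        also have "\<dots> = (\<Sum>x\<in>A. (if x \<in> A then a x else 0) * x $ i)"
          using fin A(2) by (intro sum.mono_neutral_right) auto
        also have "\<dots> = (\<Sum>x\<in>A. a x * x $ i)" by simp
        also have "\<dots> = lincomb a A $ i"
          using lincomb_index[OF i, of A a] A(2) uF by auto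
        finally show ?thesis using A(3) i by simp
      qed
      then have "\<forall>e\<in>F. ?c e = 0" by (intro coeffs)
      moreover obtain e where "e \<in> F" "v = u e" using A(2,4) by blast
      ultimately show False using A(4,5) by auto
    qed
    with inj show "inj_on u F \<and> lin_indpt (u ` F)" ..
  next
    assume R: "inj_on u F \<and> lin_indpt (u ` F)"
    show "lin_indpt_family n u F"
      unfolding lin_indpt_family_def
    proof (intro allI impI ballI, rule ccontr)
      fix c e
      assume z: "finsum_vec TYPE('a) n (\<lambda>e. c e \<cdot>\<^sub>v u e) F = 0\<^sub>v n" and e: "e \<in> F" "c e \<noteq> 0"
      let ?a = "\<lambda>x. c (the_inv_into F u x)"
      have inv: "the_inv_into F u (u e) = e" if "e \<in> F" for e
        using R that by (simp add: the_inv_into_f_f)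
      have "lincomb ?a (u ` F) = 0\<^sub>v n"
      proof (rule eq_vecI)
        fix i assume "i < dim_vec (0\<^sub>v n :: 'a vec)"
        then have i: "i < n" by simp
        have "lincomb ?a (u ` F) $ i = (\<Sum>x\<in>u ` F. ?a x * x $ i)"
          using lincomb_index[OF i uF] .
        also have "\<dots> = (\<Sum>e\<in>F. c e * u e $ i)"
          using R by (simp add: sum.reindex inv)
        finally show "lincomb ?a (u ` F) $ i = 0\<^sub>v n $ i"
          using z i zero_iff[of c] by simp
      qed (use lincomb_dim[of "u ` F" ?a] fin uF in auto)
      then have "lin_dep (u ` F)"
        unfolding lin_dep_def using fin e inv
        by (intro exI[of _ "u ` F"] exI[of _ ?a] exI[of _ "u e"]) auto
      with R show False by blast
    qed
  qed
qed

end

theory Submission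
  imports Defs "HOL-Library.Poly_Mapping"
begin

text \<open>
  The ultra triple is realised inside the group ring \<open>R = K[V]\<close>: as \<open>K\<close> has at least \<open>|E|\<close>
  elements, there are \<open>x\<^sub>e \<in> R\<close> such that \<open>x\<^sub>e - x\<^sub>f\<close> has order exactly \<open>- d(e, f)\<close>.  Enumerate
  \<open>E\<close> greedily as \<open>a\<^sub>0, a\<^sub>1, \<dots>\<close>, each \<open>a\<^sub>i\<close> maximising the gain in perimeter over \<open>a\<^sub>0, \<dots>, a\<^bsub>i-1\<^esub>\<close>,
  and let \<open>\<rho>\<^sub>i\<close> be this gain.  By the greedy choice, the Newton polynomials
  \<open>N\<^sub>i(e) = t\<^bsup>-w(e)\<^esup> \<Prod>\<^bsub>l<i\<^esub> (x\<^sub>e - x\<^bsub>a l\<^esub>)\<close> have order at least \<open>-\<rho>\<^sub>i\<close>; the \<open>i\<close>-th coordinate of the vector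
  of \<open>e\<close> is its coefficient at the exponent \<open>-\<rho>\<^sub>i\<close>.  For a \<open>k\<close>-element set \<open>F\<close>, the determinant of the
  \<open>N\<^sub>i(e)\<close> with \<open>i < k\<close> and \<open>e \<in> F\<close> is a Vandermonde product of order exactly \<open>-PER(F)\<close>, and its
  coefficient at \<open>-(\<rho>\<^sub>0 + \<dots> + \<rho>\<^bsub>k-1\<^esub>) = -PER {a\<^sub>0, \<dots>, a\<^bsub>k-1\<^esub>}\<close> is the determinant of the truncated
  vectors.  So \<open>PER(F) \<le> PER {a\<^sub>0, \<dots>, a\<^bsub>k-1\<^esub>}\<close>, with equality iff these vectors are independent.
\<close>


section \<open>Determinants\<close>

text \<open>A linear combination of the family is the matrix with columns \<open>u (f j)\<close>
  applied to the coefficient vector, so independence means trivial kernel.\<close>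

lemma lin_indpt_family_iff_det:
  fixes u :: "'e \<Rightarrow> 'k::field vec"
  assumes f: "bij_betw f {..<k} F" and u: "\<And>e. e \<in> F \<Longrightarrow> u e \<in> carrier_vec k"
  shows "lin_indpt_family k u F \<longleftrightarrow> det (mat k k (\<lambda>(i, j). u (f j) $ i)) \<noteq> 0"
proof -
  define A where "A = mat k k (\<lambda>(i, j). u (f j) $ i)"
  have A: "A \<in> carrier_mat k k" by (simp add: A_def)
  have fin: "finite F" using f bij_betw_finite by auto
  have ix: "finsum_vec TYPE('k) k (\<lambda>e. c e \<cdot>\<^sub>v u e) F = A *\<^sub>v vec k (c \<circ> f)" for c
  proof (rule eq_vecI)
    have cl: "finsum_vec TYPE('k) k (\<lambda>e. c e \<cdot>\<^sub>v u e) F \<in> carrier_vec k"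
      using u by (intro finsum_vec_closed) auto
    then show "dim_vec (finsum_vec TYPE('k) k (\<lambda>e. c e \<cdot>\<^sub>v u e) F) = dim_vec (A *\<^sub>v vec k (c \<circ> f))"
      using A by auto
    fix i assume "i < dim_vec (A *\<^sub>v vec k (c \<circ> f))"
    then have i: "i < k" using A by auto
    have "finsum_vec TYPE('k) k (\<lambda>e. c e \<cdot>\<^sub>v u e) F $ i = (\<Sum>e\<in>F. (c e \<cdot>\<^sub>v u e) $ i)"
      using u by (intro index_finsum_vec[OF fin i]) auto
    also have "\<dots> = (\<Sum>e\<in>F. c e * u e $ i)"
    proof (rule sum.cong)
      fix e assume "e \<in> F"
      then have "dim_vec (u e) = k" using u by auto
      then show "(c e \<cdot>\<^sub>v u e) $ i = c e * u e $ i" using i by simp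
    qed simp
    also have "\<dots> = (\<Sum>j<k. c (f j) * u (f j) $ i)"
      by (rule sum.reindex_bij_betw[OF f, symmetric])
    also have "\<dots> = (A *\<^sub>v vec k (c \<circ> f)) $ i"
      using i by (simp add: A_def scalar_prod_def atLeast0LessThan mult.commute)
    finally show "finsum_vec TYPE('k) k (\<lambda>e. c e \<cdot>\<^sub>v u e) F $ i = (A *\<^sub>v vec k (c \<circ> f)) $ i" .
  qed
  have inj: "inj_on f {..<k}" and im: "F = f ` {..<k}"
    using f by (auto simp: bij_betw_def)
  have "lin_indpt_family k u F \<longleftrightarrow>
      (\<forall>v \<in> carrier_vec k. A *\<^sub>v v = 0\<^sub>v k \<longrightarrow> v = 0\<^sub>v k)"
  proof
    assume L: "lin_indpt_family k u F"
    show "\<forall>v \<in> carrier_vec k. A *\<^sub>v v = 0\<^sub>v k \<longrightarrow> v = 0\<^sub>v k"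
    proof (intro ballI impI)
      fix v assume v: "v \<in> carrier_vec k" "A *\<^sub>v v = 0\<^sub>v k"
      define c where "c e = v $ the_inv_into {..<k} f e" for e
      have cf: "c (f j) = v $ j" if "j < k" for j
        using that inj by (simp add: c_def the_inv_into_f_f)
      have "vec k (c \<circ> f) = v"
        using v(1) cf by (intro eq_vecI) auto
      with ix[of c] v(2) L have "\<forall>e\<in>F. c e = 0"
        unfolding lin_indpt_family_def by metis
      then show "v = 0\<^sub>v k"
        using v(1) cf im by (intro eq_vecI) (force, simp)
    qed
  next
    assume R: "\<forall>v \<in> carrier_vec k. A *\<^sub>v v = 0\<^sub>v k \<longrightarrow> v = 0\<^sub>v k"
    show "lin_indpt_family k u F"
      unfolding lin_indpt_family_def ix
    proof (intro allI impI)
      fix c assume "A *\<^sub>v vec k (c \<circ> f) = 0\<^sub>v k"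
      then have z: "vec k (c \<circ> f) = 0\<^sub>v k" using R by simp
      have "c (f j) = 0" if "j < k" for j
        using arg_cong[OF z, of "\<lambda>v. v $ j"] that by simp
      then show "\<forall>e\<in>F. c e = 0" using im by auto
    qed
  qed
  then show ?thesis
    using det_0_iff_vec_prod_zero[OF A] unfolding A_def by blast
qed

lemma det_mult_columns:
  fixes c :: "nat \<Rightarrow> 'a::comm_ring_1"
  shows "det (mat n n (\<lambda>(i, j). c j * f i j)) = (\<Prod>j<n. c j) * det (mat n n (\<lambda>(i, j). f i j))"
proof -
  have "det (mat n n (\<lambda>(i, j). c j * f i j)) =
      (\<Sum>p | p permutes {0..<n}. signof p * (\<Prod>j<n. c j * f (p j) j))"
    by (subst det_col[of _ n]) (auto intro!: sum.cong prod.cong arg_cong2[of _ _ _ _ "(*)"])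
  also have "\<dots> = (\<Prod>j<n. c j) * (\<Sum>p | p permutes {0..<n}. signof p * (\<Prod>j<n. f (p j) j))"
    by (simp add: prod.distrib sum_distrib_left mult_ac)
  also have "(\<Sum>p | p permutes {0..<n}. signof p * (\<Prod>j<n. f (p j) j)) =
      det (mat n n (\<lambda>(i, j). f i j))"
    by (subst det_col[of _ n]) (auto intro!: sum.cong prod.cong arg_cong2[of _ _ _ _ "(*)"])
  finally show ?thesis .
qed

text \<open>The rows evaluate monic polynomials of degrees 0, 1, ..., so the nodes
  \<open>a l\<close> cannot influence the determinant. Once \<open>x 0\<close> is made the first
  node, column 0 becomes (1, 0, ..., 0), and its minor is the same determinant for the points
  \<open>x (Suc j)\<close>, with column factors \<open>x (Suc j) - x 0\<close>.\<close>

lemma det_newton_vandermonde: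
  fixes a x :: "nat \<Rightarrow> 'a::comm_ring_1"
  shows "det (mat n n (\<lambda>(i, j). \<Prod>l<i. x j - a l)) = (\<Prod>j<n. \<Prod>i<j. x j - x i)"
proof (induction n arbitrary: x)
  case 0
  then show ?case by simp
next
  case (Suc n)
  define M where "M = mat (Suc n) (Suc n) (\<lambda>(i, j). \<Prod>l<i. x j - a l)"
  \<comment> \<open>Left multiplication by \<open>L\<close> replaces the nodes \<open>a 0, a 1, \<dots>\<close> by \<open>x 0, a 0, a 1, \<dots>\<close>.\<close>
  define L where "L = mat (Suc n) (Suc n)
    (\<lambda>(i, j). if i = j then 1 else if i = Suc j then a j - x 0 else 0)"
  have M: "M \<in> carrier_mat (Suc n) (Suc n)" and L: "L \<in> carrier_mat (Suc n) (Suc n)"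
    by (simp_all add: M_def L_def)
  have "det L = 1"
    by (subst det_lower_triangular[OF _ L]) (auto simp: L_def prod_list_diag_prod)
  then have "det M = det (L * M)"
    by (simp add: det_mult[OF L M])
  have LM: "L * M \<in> carrier_mat (Suc n) (Suc n)" using L M by simp
  have entry: "(L * M) $$ (i, j) = (\<Sum>m<Suc n. L $$ (i, m) * M $$ (m, j))"
    if "i < Suc n" "j < Suc n" for i j
    using that L M by (simp add: scalar_prod_def atLeast0LessThan)
  have entry_0: "(L * M) $$ (0, j) = 1" if "j < Suc n" for j
  proof -
    have "(L * M) $$ (0, j) = (\<Sum>m<Suc n. L $$ (0, m) * M $$ (m, j))"
      using that by (simp only: entry)
    also have "\<dots> = (\<Sum>m<Suc n. if m = 0 then 1 else 0)"
      using that by (intro sum.cong) (auto simp: L_def M_def)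
    finally show ?thesis by (simp add: sum.delta)
  qed
  have entry_Suc: "(L * M) $$ (Suc i, j) = (x j - x 0) * (\<Prod>l<i. x j - a l)"
    if "i < n" "j < Suc n" for i j
  proof -
    have "(L * M) $$ (Suc i, j) = (\<Sum>m<Suc n. L $$ (Suc i, m) * M $$ (m, j))"
      using that by (simp only: entry)
    also have "\<dots> = (\<Sum>m<Suc n. (if m = Suc i then M $$ (Suc i, j) else 0)
        + (if m = i then (a i - x 0) * M $$ (i, j) else 0))"
      using that by (intro sum.cong) (auto simp: L_def)
    also have "\<dots> = M $$ (Suc i, j) + (a i - x 0) * M $$ (i, j)"
      using that by (simp only: sum.distrib sum.delta finite_lessThan) simp
    \<comment> \<open>The cofactors of the common product add up:
      \<open>(x j - a i) + (a i - x 0) = x j - x 0\<close>.\<close>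
    also have "\<dots> = (x j - x 0) * (\<Prod>l<i. x j - a l)"
      using that by (simp add: M_def algebra_simps)
    finally show ?thesis .
  qed
  have "det (L * M) = (\<Sum>i<Suc n. (L * M) $$ (i, 0) * cofactor (L * M) i 0)"
    by (rule laplace_expansion_column[OF LM]) simp
  also have "\<dots> = cofactor (L * M) 0 0"
    by (simp only: sum.lessThan_Suc_shift) (simp add: entry_0 entry_Suc)
  also have "\<dots> = det (mat_delete (L * M) 0 0)"
    by (simp add: cofactor_def)
  also have "mat_delete (L * M) 0 0 =
      mat n n (\<lambda>(i, j). (x (Suc j) - x 0) * (\<Prod>l<i. x (Suc j) - a l))"
    by (intro eq_matI)
      (auto simp: mat_delete_def entry_Suc carrier_matD[OF LM] simp del: index_mult_mat)
  also have "det \<dots> = (\<Prod>j<n. x (Suc j) - x 0) * (\<Prod>j<n. \<Prod>i<j. x (Suc j) - x (Suc i))"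
    by (subst det_mult_columns) (simp add: Suc.IH)
  also have "\<dots> = (\<Prod>j<Suc n. \<Prod>i<j. x j - x i)"
    by (simp only: prod.lessThan_Suc_shift prod.distrib) simp
  finally show ?case
    using \<open>det M = det (L * M)\<close> by (simp add: M_def)
qed


section \<open>Leading coefficients in the group ring\<close>

text \<open>
  \<open>'v \<Rightarrow>\<^sub>0 'k\<close> is the group ring, \<open>Poly_Mapping.single g c\<close> being the monomial \<open>c t\<^sup>g\<close>.
  The coefficient \<open>c\<close> below may be zero, so that \<open>g\<close> is only a lower bound for the order of \<open>p\<close>.
\<close>

definition has_lead :: "'v::linordered_ab_group_add \<Rightarrow> ('v \<Rightarrow>\<^sub>0 'k::field) \<Rightarrow> 'k \<Rightarrow> bool" where
  "has_lead g p c \<longleftrightarrow> (\<forall>h<g. Poly_Mapping.lookup p h = 0) \<and> Poly_Mapping.lookup p g = c"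

lemma has_lead_0: "has_lead g 0 0"
  by (simp add: has_lead_def)

lemma has_lead_single: "has_lead g (Poly_Mapping.single g c) c"
  by (auto simp: has_lead_def lookup_single when_def)

lemma has_lead_uminus: "has_lead g p c \<Longrightarrow> has_lead g (- p) (- c)"
  by (simp add: has_lead_def)

lemma has_lead_sum:
  "(\<And>i. i \<in> I \<Longrightarrow> has_lead g (p i) (c i)) \<Longrightarrow> has_lead g (\<Sum>i\<in>I. p i) (\<Sum>i\<in>I. c i)"
  by (simp add: has_lead_def lookup_sum)

text \<open>Split off the monomials at \<open>g\<close> and \<open>h\<close>: every other product
  has a factor strictly above its bound and, addition being strictly monotone, contributes only
  above \<open>g + h\<close>.\<close>

lemma has_lead_mult:
  assumes p: "has_lead g p c" and q: "has_lead h q c'"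
  shows "has_lead (g + h) (p * q) (c * c')"
proof -
  define p' where "p' = p - Poly_Mapping.single g c"
  define q' where "q' = q - Poly_Mapping.single h c'"
  have p': "g < k" if "k \<in> Poly_Mapping.keys p'" for k
    using that p by (cases k g rule: linorder_cases)
      (auto simp: p'_def has_lead_def in_keys_iff lookup_minus lookup_single)
  have q': "h < k" if "k \<in> Poly_Mapping.keys q'" for k
    using that q by (cases k h rule: linorder_cases)
      (auto simp: q'_def has_lead_def in_keys_iff lookup_minus lookup_single)
  have q0: "h \<le> k" if "k \<in> Poly_Mapping.keys q" for k
    using that q by (metis has_lead_def in_keys_iff not_le)
  have pq: "p * q = Poly_Mapping.single (g + h) (c * c') + (Poly_Mapping.single g c * q' + p' * q)"
    by (simp add: p'_def q'_def algebra_simps flip: mult_single)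
  have "g + h < k" if "k \<in> Poly_Mapping.keys (Poly_Mapping.single g c * q')" for k
    using that keys_mult[of "Poly_Mapping.single g c" q'] q'
    by (force split: if_splits)
  moreover have "g + h < k" if "k \<in> Poly_Mapping.keys (p' * q)" for k
    using that keys_mult[of p' q] p' q0 by (force intro: add_less_le_mono)
  ultimately have "Poly_Mapping.lookup (Poly_Mapping.single g c * q' + p' * q) k = 0" if "k \<le> g + h" for k
    using that by (metis add.right_neutral in_keys_iff lookup_add not_le)
  then show ?thesis
    unfolding pq by (auto simp: has_lead_def lookup_add lookup_single)
qed

lemma has_lead_prod:
  "finite I \<Longrightarrow> (\<And>i. i \<in> I \<Longrightarrow> has_lead (g i) (p i) (c i)) \<Longrightarrow>
    has_lead (\<Sum>i\<in>I. g i) (\<Prod>i\<in>I. p i) (\<Prod>i\<in>I. c i)"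
proof (induction I rule: finite_induct)
  case empty
  then show ?case using has_lead_single[of 0 1] by simp
qed (simp add: has_lead_mult)

text \<open>The bound \<open>g i\<close> depends on the row only, and each Leibniz term takes one
  entry per row. So all terms share the same bound, and their coefficients there add up to a
  determinant.\<close>

lemma has_lead_det:
  assumes "\<And>i j. i < n \<Longrightarrow> j < n \<Longrightarrow> has_lead (g i) (P i j) (c i j)"
  shows "has_lead (\<Sum>i<n. g i) (det (mat n n (\<lambda>(i, j). P i j))) (det (mat n n (\<lambda>(i, j). c i j)))"
proof -
  have perm: "has_lead (\<Sum>i<n. g i) (signof p * (\<Prod>i=0..<n. P i (p i))) (signof p * (\<Prod>i=0..<n. c i (p i)))"
    if p: "p permutes {0..<n}" for p
  proof -
    have "has_lead (\<Sum>i=0..<n. g i) (\<Prod>i=0..<n. P i (p i)) (\<Prod>i=0..<n. c i (p i))"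
      using permutes_in_image[OF p] by (intro has_lead_prod assms) auto
    then show ?thesis
      by (auto simp: sign_def has_lead_uminus atLeast0LessThan)
  qed
  have det_mat: "det (mat n n (\<lambda>(i, j). B i j)) =
      (\<Sum>p | p permutes {0..<n}. signof p * (\<Prod>i=0..<n. B i (p i)))" for B :: "nat \<Rightarrow> nat \<Rightarrow> 'x::comm_ring_1"
    by (subst det_def'[of _ n])
      (auto intro!: sum.cong prod.cong arg_cong2[of _ _ _ _ "(*)"] simp: permutes_in_image)
  show ?thesis
    unfolding det_mat using perm by (intro has_lead_sum) auto
qed

text \<open>A nonzero \<open>c'\<close> makes \<open>h\<close> the true order of \<open>p\<close>,
  while \<open>g\<close> is only a lower bound. Applied to the determinant, this compares the two
  perimeters.\<close>

lemma has_lead_unique_order: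
  assumes "has_lead g p c" "has_lead h p c'" "c' \<noteq> 0"
  shows "g \<le> h" "g = h \<longleftrightarrow> c \<noteq> 0"
  using assms by (auto simp: has_lead_def) (metis linorder_cases not_le)+


section \<open>Ultra triples\<close>

lemma ultra_triple_sym:
  "ultra_triple E w d \<Longrightarrow> a \<in> E \<Longrightarrow> b \<in> E \<Longrightarrow> a \<noteq> b \<Longrightarrow> d a b = d b a"
  unfolding ultra_triple_def by blast

text \<open>Two points in an open ball around \<open>c\<close> are closer than its radius. The cases
  \<open>c = a\<close> and \<open>c = b\<close> are separate because \<open>d\<close> is arbitrary
  on the diagonal.\<close>

lemma ultra_triple_less:
  assumes "ultra_triple E w d" "a \<in> E" "b \<in> E" "c \<in> E" "a \<noteq> b"
    and "c = a \<or> d a c < r" "c = b \<or> d b c < r"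
  shows "d a b < r"
proof (cases "c = a \<or> c = b")
  case True
  then show ?thesis using assms ultra_triple_sym[OF assms(1-3)] by auto
next
  case False
  have "\<forall>a\<in>E. \<forall>b\<in>E. \<forall>c\<in>E. a \<noteq> b \<and> a \<noteq> c \<and> b \<noteq> c \<longrightarrow> d a b \<le> max (d a c) (d b c)"
    using assms(1) unfolding ultra_triple_def by (rule conjunct2)
  then have "d a b \<le> max (d a c) (d b c)"
    using assms(2-5) False by auto
  also have "\<dots> < r" using False assms(6,7) by simp
  finally show ?thesis .
qed

text \<open>
  For a distance \<open>r\<close>, the coefficient of \<open>x e\<close> at \<open>t\<^bsup>-r\<^esup>\<close> encodes the open ball of radius \<open>r\<close>
  around \<open>e\<close>: it agrees
  for distinct \<open>e\<close> and \<open>f\<close> exactly if \<open>d e f < r\<close>.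
\<close>

lemma ultra_triple_embedding:
  fixes d :: "'e \<Rightarrow> 'e \<Rightarrow> 'v::linordered_ab_group_add"
  assumes fin: "finite E" and ut: "ultra_triple E w d" and "E \<lesssim> (UNIV :: 'k::field set)"
  obtains x :: "'e \<Rightarrow> 'v \<Rightarrow>\<^sub>0 'k::field" and c :: "'e \<Rightarrow> 'e \<Rightarrow> 'k"
  where "\<And>e f. e \<in> E \<Longrightarrow> f \<in> E \<Longrightarrow> e \<noteq> f \<Longrightarrow> has_lead (- d e f) (x e - x f) (c e f)"
    and "\<And>e f. e \<in> E \<Longrightarrow> f \<in> E \<Longrightarrow> e \<noteq> f \<Longrightarrow> c e f \<noteq> 0"
proof -
  obtain \<phi> :: "'e \<Rightarrow> 'k" where \<phi>: "inj_on \<phi> E"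
    using assms(3) unfolding lepoll_def by auto
  define ball where "ball r e = {f \<in> E. f = e \<or> d e f < r}" for r e
  \<comment> \<open>The choice depends only on the set \<open>ball r e\<close>, so equal balls share
    a representative; \<open>\<phi>\<close> then labels representatives injectively by
    scalars.\<close>
  define rep where "rep r e = (SOME f. f \<in> ball r e)" for r e
  have rep: "rep r e \<in> ball r e" if "e \<in> E" for r e
    unfolding rep_def
    by (rule someI[of "\<lambda>f. f \<in> ball r e" e]) (use that in \<open>simp add: ball_def\<close>)
  have subset: "ball r e \<subseteq> ball r f" if "e \<in> E" "f \<in> E" "d f e < r" for r e f
  proof
    fix g assume "g \<in> ball r e"
    then have g: "g \<in> E" "g = e \<or> d e g < r" by (auto simp: ball_def)
    show "g \<in> ball r f"
    proof (cases "g = f \<or> g = e")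
      case True
      then show ?thesis using that g by (auto simp: ball_def)
    next
      case False
      then have "d f g < r"
        using that g ut ultra_triple_sym[OF ut, of g e]
        by (intro ultra_triple_less[OF ut, of f g e]) auto
      then show ?thesis using g by (simp add: ball_def)
    qed
  qed
  have rep_eq: "rep r e = rep r f" if "e \<in> E" "f \<in> E" "e \<noteq> f" "d e f < r" for r e f
  proof -
    have "ball r e = ball r f"
      using that subset ultra_triple_sym[OF ut, of e f] by (intro equalityI) auto
    then show ?thesis by (simp add: rep_def)
  qed
  \<comment> \<open>A common representative would lie in both open balls of radius
    \<open>d e f\<close>, which are disjoint.\<close>
  have rep_neq: "rep (d e f) e \<noteq> rep (d e f) f" if "e \<in> E" "f \<in> E" "e \<noteq> f" for e f
  proof
    assume eq: "rep (d e f) e = rep (d e f) f"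
    have "d e f < d e f"
      using that rep[of e "d e f"] rep[of f "d e f"] eq
      by (intro ultra_triple_less[OF ut, of e f "rep (d e f) e"]) (auto simp: ball_def)
    then show False by simp
  qed
  define R where "R = (\<lambda>(e, f). d e f) ` (E \<times> E)"
  have R: "finite R" using fin by (simp add: R_def)
  define x where "x e = (\<Sum>r\<in>R. Poly_Mapping.single (- r) (\<phi> (rep r e)))" for e
  have lookup_x: "Poly_Mapping.lookup (x e) (- r) = (if r \<in> R then \<phi> (rep r e) else 0)" for e r
    using R by (simp add: x_def lookup_sum lookup_single when_def)
  define c where "c e f = \<phi> (rep (d e f) e) - \<phi> (rep (d e f) f)" for e f
  show thesis
  proof
    fix e f assume ef: "e \<in> E" "f \<in> E" "e \<noteq> f"
    have "d e f \<in> R" using ef by (auto simp: R_def)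
    then have "Poly_Mapping.lookup (x e - x f) (- d e f) = c e f"
      by (simp add: lookup_minus lookup_x c_def)
    moreover have "Poly_Mapping.lookup (x e - x f) h = 0" if "h < - d e f" for h
    proof -
      \<comment> \<open>The exponent \<open>h\<close> belongs to the radius \<open>- h\<close>, at
        which \<open>e\<close> and \<open>f\<close> have the same ball, so their coefficients
        cancel.\<close>
      have "d e f < - h" using that less_minus_iff by blast
      then show ?thesis
        using rep_eq[OF ef] lookup_x[of _ "- h"] by (simp add: lookup_minus)
    qed
    ultimately show "has_lead (- d e f) (x e - x f) (c e f)"
      by (simp add: has_lead_def)
    have "rep (d e f) e \<in> E" "rep (d e f) f \<in> E"
      using rep[OF ef(1), of "d e f"] rep[OF ef(2), of "d e f"] by (auto simp: ball_def)
    then show "c e f \<noteq> 0"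
      using rep_neq[OF ef] \<phi> by (auto simp: c_def inj_on_eq_iff)
  qed
qed

text \<open>Points are added in the order of \<open>f\<close>, each bringing its weight and its
  distances to earlier points. This serves both the greedy prefixes and arbitrary sets.\<close>

lemma PER_image:
  fixes f :: "nat \<Rightarrow> 'e"
  assumes "inj_on f {..<k}"
    and "\<And>a b. a \<in> f ` {..<k} \<Longrightarrow> b \<in> f ` {..<k} \<Longrightarrow> a \<noteq> b \<Longrightarrow> d a b = d b a"
  shows "PER w d (f ` {..<k}) = (\<Sum>j<k. w (f j) + (\<Sum>i<j. d (f j) (f i)))"
  using assms
proof (induction k)
  case (Suc k)
  have inj: "inj_on f {..<k}" and new: "f k \<notin> f ` {..<k}"
    using Suc.prems(1) by (auto simp: lessThan_Suc)
  have "PER w d (insert (f k) (f ` {..<k})) =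
      PER w d (f ` {..<k}) + w (f k) + (\<Sum>a\<in>f ` {..<k}. d (f k) a)"
    using new by (intro PER_insert Suc.prems(2)) (auto simp: lessThan_Suc)
  also have "PER w d (f ` {..<k}) = (\<Sum>j<k. w (f j) + (\<Sum>i<j. d (f j) (f i)))"
    using inj by (intro Suc.IH Suc.prems(2)) (auto simp: lessThan_Suc)
  also have "(\<Sum>a\<in>f ` {..<k}. d (f k) a) = (\<Sum>i<k. d (f k) (f i))"
    using inj by (simp add: sum.reindex)
  finally show ?case by (simp add: lessThan_Suc add.assoc)
qed simp

lemma greedy_enumeration:
  fixes s :: "'e set \<Rightarrow> 'e \<Rightarrow> 'v::linorder"
  assumes "finite E"
  obtains a where "bij_betw a {..<card E} E"
    and "\<And>k e. k < card E \<Longrightarrow> e \<in> E - a ` {..<k} \<Longrightarrow> s (a ` {..<k}) e \<le> s (a ` {..<k}) (a k)"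
proof -
  have "\<exists>a. inj_on a {..<n} \<and> a ` {..<n} \<subseteq> E \<and>
      (\<forall>k<n. \<forall>e\<in>E - a ` {..<k}. s (a ` {..<k}) e \<le> s (a ` {..<k}) (a k))"
    if "n \<le> card E" for n
    using that
  proof (induction n)
    case (Suc n)
    then obtain a where a: "inj_on a {..<n}" "a ` {..<n} \<subseteq> E"
      "\<And>k e. k < n \<Longrightarrow> e \<in> E - a ` {..<k} \<Longrightarrow> s (a ` {..<k}) e \<le> s (a ` {..<k}) (a k)"
      by auto
    let ?S = "s (a ` {..<n}) ` (E - a ` {..<n})"
    have "card (a ` {..<n}) < card E"
      using a(1) Suc.prems by (simp add: card_image)
    then have ne: "?S \<noteq> {}" using a(2) by auto
    have fS: "finite ?S" using assms by simp
    obtain y where y: "y \<in> E - a ` {..<n}" "s (a ` {..<n}) y = Max ?S"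
      using Max_in[OF fS ne] by auto
    have max: "s (a ` {..<n}) e \<le> s (a ` {..<n}) y" if "e \<in> E - a ` {..<n}" for e
      using that y(2) fS by simp
    \<comment> \<open>Changing \<open>a\<close> at \<open>n\<close> leaves the prefixes up to length
      \<open>n\<close> alone, so the earlier greedy inequalities persist.\<close>
    have im: "a(n := y) ` {..<k} = a ` {..<k}" if "k \<le> n" for k
      using that by (intro image_cong) auto
    show ?case
    proof (intro exI[of _ "a(n := y)"] conjI allI impI ballI)
      show "inj_on (a(n := y)) {..<Suc n}"
        using a(1) y(1) by (auto simp: lessThan_Suc inj_on_def)
      show "a(n := y) ` {..<Suc n} \<subseteq> E"
        using a(2) y(1) im[of n] by (auto simp: lessThan_Suc)
      fix k e assume "k < Suc n" "e \<in> E - a(n := y) ` {..<k}"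
      then show "s (a(n := y) ` {..<k}) e \<le> s (a(n := y) ` {..<k}) ((a(n := y)) k)"
        using a(3) max im[of k] by (cases "k = n") auto
    qed
  qed simp
  from this[OF order_refl] obtain a where a: "inj_on a {..<card E}" "a ` {..<card E} \<subseteq> E"
      "\<And>k e. k < card E \<Longrightarrow> e \<in> E - a ` {..<k} \<Longrightarrow> s (a ` {..<k}) e \<le> s (a ` {..<k}) (a k)"
    by auto
  have "a ` {..<card E} = E"
    using a(1,2) assms by (intro card_subset_eq) (auto simp: card_image)
  then show thesis using that a by (auto simp: bij_betw_def)
qed

section \<open>The Bhargava greedoid\<close>

theorem theorem3p1:
  fixes E :: "'e set"
    and w :: "'e \<Rightarrow> 'v::linordered_ab_group_add"
    and d :: "'e \<Rightarrow> 'e \<Rightarrow> 'v"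
  assumes "finite E"
    and "ultra_triple E w d"
    and "E \<lesssim> (UNIV :: 'k::field set)"
  shows "\<exists>m (v :: 'e \<Rightarrow> 'k vec).
           vector_family m E v \<and>
           bhargava_greedoid E w d = gaussian_elimination_greedoid E v"
proof -
  note fin = assms(1) and ut = assms(2)
  obtain x :: "'e \<Rightarrow> 'v \<Rightarrow>\<^sub>0 'k" and c
    where x: "\<And>e f. e \<in> E \<Longrightarrow> f \<in> E \<Longrightarrow> e \<noteq> f \<Longrightarrow> has_lead (- d e f) (x e - x f) (c e f)"
      and c: "\<And>e f. e \<in> E \<Longrightarrow> f \<in> E \<Longrightarrow> e \<noteq> f \<Longrightarrow> c e f \<noteq> 0"
    using ultra_triple_embedding[OF assms] by blast
  obtain a where a: "bij_betw a {..<card E} E"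
    and greedy: "\<And>k e. k < card E \<Longrightarrow> e \<in> E - a ` {..<k} \<Longrightarrow>
      w e + (\<Sum>b\<in>a ` {..<k}. d e b) \<le> w (a k) + (\<Sum>b\<in>a ` {..<k}. d (a k) b)"
    using greedy_enumeration[OF fin, of "\<lambda>A e. w e + (\<Sum>b\<in>A. d e b)"] by blast
  have inj: "inj_on a {..<k}" if "k \<le> card E" for k
    using a that by (auto simp: bij_betw_def intro: inj_on_subset)
  have aE: "a i \<in> E" if "i < card E" for i
    using a that by (auto simp: bij_betw_def)
  define \<rho> where "\<rho> i = w (a i) + (\<Sum>l<i. d (a i) (a l))" for i
  define N where "N e i = Poly_Mapping.single (- w e) 1 * (\<Prod>l<i. x e - x (a l))" for e i
  define v where "v e = vec (card E) (\<lambda>i. Poly_Mapping.lookup (N e i) (- \<rho> i))" for e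
  have N: "has_lead (- \<rho> i) (N e i) (v e $ i)" if e: "e \<in> E" and i: "i < card E" for e i
  proof (cases "e \<in> a ` {..<i}")
    case True
    then have "N e i = 0" by (auto simp: N_def)
    then show ?thesis using i by (simp add: v_def has_lead_0)
  next
    case False
    \<comment> \<open>\<open>- ?h\<close> is the gain of adding \<open>e\<close> to the first
      \<open>i\<close> greedy points. It is at most \<open>\<rho> i\<close>, so \<open>N e i\<close>
      has no terms below \<open>- \<rho> i\<close>.\<close>
    let ?h = "- w e + (\<Sum>l<i. - d e (a l))"
    have "has_lead ?h (N e i) (1 * (\<Prod>l<i. c e (a l)))"
      unfolding N_def using False e i aE
      by (intro has_lead_mult has_lead_single has_lead_prod x) auto
    moreover have "w e + (\<Sum>l<i. d e (a l)) \<le> \<rho> i"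
      using greedy[OF i, of e] e False inj[of i] i
      by (simp add: \<rho>_def sum.reindex)
    from le_imp_neg_le[OF this] have "- \<rho> i \<le> ?h"
      by (simp add: sum_negf)
    ultimately show ?thesis
      using i by (auto simp: v_def has_lead_def)
  qed
  have main: "PER w d F \<le> PER w d (a ` {..<card F}) \<and>
      (PER w d F = PER w d (a ` {..<card F}) \<longleftrightarrow>
        lin_indpt_family (card F) (\<lambda>e. vec_first (v e) (card F)) F)" if F: "F \<subseteq> E" for F
  proof -
    define k where "k = card F"
    have finF: "finite F" and k: "k \<le> card E"
      using F fin by (auto simp: k_def finite_subset card_mono)
    obtain f where f: "bij_betw f {..<k} F"
      using finF bij_betw_from_nat_into_finite unfolding k_def by blast
    have fE: "f j \<in> E" if "j < k" for j using f F that by (auto simp: bij_betw_def)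
    have f_inj: "f i \<noteq> f j" if "i < j" "j < k" for i j
      using f that by (auto simp: bij_betw_def inj_on_def)
    have "has_lead (\<Sum>i<k. - \<rho> i) (det (mat k k (\<lambda>(i, j). N (f j) i)))
        (det (mat k k (\<lambda>(i, j). v (f j) $ i)))"
      using fE k by (intro has_lead_det N) auto
    moreover have "PER w d (a ` {..<k}) = (\<Sum>i<k. \<rho> i)"
      unfolding \<rho>_def using k inj aE ultra_triple_sym[OF ut]
      by (intro PER_image) auto
    ultimately have lower: "has_lead (- PER w d (a ` {..<k}))
        (det (mat k k (\<lambda>(i, j). N (f j) i))) (det (mat k k (\<lambda>(i, j). v (f j) $ i)))"
      by (simp add: sum_negf)
    \<comment> \<open>The weights factor out of the columns, and the greedy nodes
      \<open>x (a l)\<close> disappear, leaving only differences within \<open>F\<close>.\<close>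
    have det_N: "det (mat k k (\<lambda>(i, j). N (f j) i)) =
        (\<Prod>j<k. Poly_Mapping.single (- w (f j)) 1 * (\<Prod>i<j. x (f j) - x (f i)))"
      unfolding N_def det_mult_columns
      using det_newton_vandermonde[of k "\<lambda>j. x (f j)" "\<lambda>l. x (a l)"]
      by (simp add: prod.distrib)
    have "has_lead (\<Sum>j<k. - w (f j) + (\<Sum>i<j. - d (f j) (f i)))
        (det (mat k k (\<lambda>(i, j). N (f j) i))) (\<Prod>j<k. 1 * (\<Prod>i<j. c (f j) (f i)))"
      unfolding det_N using fE f_inj
      by (intro has_lead_prod has_lead_mult has_lead_single x) (auto, metis)
    moreover have "(\<Sum>j<k. - w (f j) + (\<Sum>i<j. - d (f j) (f i))) = - PER w d F"
    proof -
      have "PER w d (f ` {..<k}) = (\<Sum>j<k. w (f j) + (\<Sum>i<j. d (f j) (f i)))"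
      proof (rule PER_image)
        show "inj_on f {..<k}" using f by (simp add: bij_betw_def)
        fix a b assume "a \<in> f ` {..<k}" "b \<in> f ` {..<k}" "a \<noteq> b"
        then show "d a b = d b a" using fE by (intro ultra_triple_sym[OF ut]) auto
      qed
      then show ?thesis
        using f by (simp add: bij_betw_def sum_negf sum.distrib sum_subtractf)
    qed
    ultimately have exact: "has_lead (- PER w d F)
        (det (mat k k (\<lambda>(i, j). N (f j) i))) (\<Prod>j<k. \<Prod>i<j. c (f j) (f i))"
      by simp
    have "(\<Prod>j<k. \<Prod>i<j. c (f j) (f i)) \<noteq> 0"
      using c fE f_inj by (auto, metis less_trans)
    note order = has_lead_unique_order[OF lower exact this]
    have "mat k k (\<lambda>(i, j). vec_first (v (f j)) k $ i) = mat k k (\<lambda>(i, j). v (f j) $ i)"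
      by (intro eq_matI) (auto simp: vec_first_def)
    then have "lin_indpt_family k (\<lambda>e. vec_first (v e) k) F \<longleftrightarrow>
        det (mat k k (\<lambda>(i, j). v (f j) $ i)) \<noteq> 0"
      using lin_indpt_family_iff_det[OF f, of "\<lambda>e. vec_first (v e) k"] by simp
    then show ?thesis
      using order by (auto simp: k_def)
  qed
  have best: "a ` {..<card F} \<subseteq> E \<and> card (a ` {..<card F}) = card F" if "F \<subseteq> E" for F
  proof -
    have "card F \<le> card E" using that fin by (simp add: card_mono)
    then show ?thesis using aE inj by (auto simp: card_image)
  qed
  have "bhargava_greedoid E w d = gaussian_elimination_greedoid E v"
    unfolding bhargava_greedoid_def gaussian_elimination_greedoid_def
  proof (intro Collect_cong conj_cong refl)
    fix F assume F: "F \<subseteq> E"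
    \<comment> \<open>The greedy prefix is itself a competitor of size \<open>card F\<close> and, by
      \<open>main\<close>, is at least as good as all others; so \<open>F\<close> is optimal iff it
      ties with the prefix.\<close>
    have "(\<forall>B. B \<subseteq> E \<and> card B = card F \<longrightarrow> PER w d B \<le> PER w d F) \<longleftrightarrow>
        PER w d F = PER w d (a ` {..<card F})"
      using main best[OF F] F by (metis order_antisym)
    then show "(\<forall>B. B \<subseteq> E \<and> card B = card F \<longrightarrow> PER w d B \<le> PER w d F) \<longleftrightarrow>
        lin_indpt_family (card F) (\<lambda>e. vec_first (v e) (card F)) F"
      using main[OF F] by simp
  qed
  moreover have "vector_family (card E) E v"
    by (simp add: vector_family_def v_def)
  ultimately show ?thesis by blast
qed

end
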